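(* Let $r\geq 3$ be an integer and let $G$ be a finite simple $K_{1,r}$-free graph. If $\delta(G)\geq \left\lceil\frac{r}{2}\right\rceil+1$, then $G$ is a $\{P_2,P_3\}$-factor covered graph, i.e., for every edge $e\in E(G)$ there is a $\{P_2,P_3\}$-factor of $G$ containing $e$.
   Context: All graphs are finite and simple. $\delta(G)$ is the minimum degree of $G$. $K_{1,r}$ denotes the star with one center vertex adjacent to $r$ leaves; $G$ is $K_{1,r}$-free if it contains no induced subgraph isomorphic to $K_{1,r}$. $P_k$ denotes the path on $k$ vertices. A $\{P_2,P_3\}$-factor of $G$ is a spanning subgraph of $G$ each of whose connected components is isomorphic to $P_2$ or $P_3$. $G$ is a $\{P_2,P_3\}$-factor covered graph if for every $e\in E(G)$ there is a $\{P_2,P_3\}$-factor of $G$ whose edge set contains $e$. *)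

theory Defs
  imports Complex_Main "Graph_Theory.Graph_Theory"
begin

text \<open>
  A finite simple graph is a symmetric digraph satisfying the locale predicate \<^const>\<open>graph\<close>:
  an undirected edge is a pair of opposite arcs. In such a digraph, the out-degree is the usual
  degree, and the strongly connected components \<^const>\<open>pre_digraph.sccs\<close> (maximal strongly
  connected induced subgraphs) are the usual connected components.
\<close>

text \<open>Unspecified for the null graph, which has no edges.\<close>

definition min_degree :: "('a,'b) pre_digraph \<Rightarrow> nat" where
  "min_degree G = Min (out_degree G ` verts G)"

definition star_free :: "nat \<Rightarrow> ('a,'b) pre_digraph \<Rightarrow> bool" where
  "star_free r G \<longleftrightarrow> \<not> (\<exists>H. induced_subgraph H G \<and> complete_bipartite_digraph 1 r H)"

text \<open>The index counts vertices, not edges.\<close>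

definition path_graph :: "nat \<Rightarrow> nat pair_pre_digraph" where
  "path_graph k = \<lparr> pverts = {0..<k},
     parcs = {(i, j). i < k \<and> j < k \<and> (j = Suc i \<or> i = Suc j)} \<rparr>"

lemma pair_graph_path_graph: "pair_graph (path_graph k)"
proof -
  have fin: "finite (parcs (path_graph k))"
    by (rule finite_subset[of _ "{0..<k} \<times> {0..<k}"]) (auto simp: path_graph_def)
  show ?thesis
    by unfold_locales (use fin in \<open>auto simp: path_graph_def symmetric_def sym_def\<close>)
qed

text \<open>A subgraph of a graph need not be symmetric, hence the requirement \<^term>\<open>graph F\<close>.\<close>

definition path_factor :: "nat set \<Rightarrow> ('a,'b) pre_digraph \<Rightarrow> ('a,'b) pre_digraph \<Rightarrow> bool" where
  "path_factor ks F G \<longleftrightarrow> graph F \<and> spanning F G \<and>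
     (\<forall>C \<in> pre_digraph.sccs F. \<exists>k \<in> ks. digraph_iso C (with_proj (path_graph k)))"

definition path_factor_covered :: "nat set \<Rightarrow> ('a,'b) pre_digraph \<Rightarrow> bool" where
  "path_factor_covered ks G \<longleftrightarrow> (\<forall>e \<in> arcs G. \<exists>F. path_factor ks F G \<and> e \<in> arcs F)"

end

theory Submission
  imports Defs "HOL-Library.Transitive_Closure_Table"
begin

text \<open>
  Take a packing by vertex-disjoint copies of \<open>P\<^sub>2\<close> and \<open>P\<^sub>3\<close> that covers as many vertices as possible.
  If \<open>u\<close> is uncovered, every neighbour of a vertex reached from \<open>u\<close> by alternating paths is the
  midpoint of an induced \<open>P\<^sub>3\<close> of the packing, and both ends of that \<open>P\<^sub>3\<close> are reached as well; so the
  reached vertices form an independent set \<open>I\<close> with \<open>|I| > 2 |N(I)|\<close>. Hence a factor exists as soon as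
  \<open>|I| \<le> 2 |N(I)|\<close> for all independent \<open>I\<close>.

  Given an edge \<open>xy\<close>, apply this to \<open>G - {x, y}\<close>. If some independent \<open>I\<close> violates the condition there,
  let \<open>T\<close> be its neighbourhood outside \<open>{x, y}\<close>. Counting the edges between \<open>I\<close> and \<open>T \<union> {x, y}\<close>
  with \<open>r - 1 \<le> 2\<delta> - 3\<close> forces \<open>|T| + 2 = \<delta>\<close> and \<open>|I| = 2 |T| + 1 \<ge> r - 1\<close>, so that \<open>I\<close> is completely
  joined to \<open>T \<union> {x, y}\<close> and, by star-freeness, no edge leaves \<open>I \<union> T \<union> {x, y}\<close>. In this case the path
  \<open>x y z\<close> with \<open>z \<in> I\<close> extends to a factor.
\<close>

section \<open>Maximum packings by short paths\<close>

text \<open>A block is kept as a bare vertex set. The path need not be induced, so a triangle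
  qualifies as well; which edges are used is fixed only by a later numbering.\<close>

definition short_path :: "('a \<Rightarrow> 'a \<Rightarrow> bool) \<Rightarrow> 'a set \<Rightarrow> bool" where
  "short_path adj B \<longleftrightarrow>
     (\<exists>a b. distinct [a, b] \<and> adj a b \<and> B = {a, b}) \<or>
     (\<exists>a b c. distinct [a, b, c] \<and> adj a b \<and> adj b c \<and> B = {a, b, c})"

definition packing :: "('a \<Rightarrow> 'a \<Rightarrow> bool) \<Rightarrow> 'a set \<Rightarrow> 'a set set \<Rightarrow> bool" where
  "packing adj V P \<longleftrightarrow> (\<forall>B\<in>P. short_path adj B) \<and> pairwise disjnt P \<and> \<Union>P \<subseteq> V"

definition nbs :: "('a \<Rightarrow> 'a \<Rightarrow> bool) \<Rightarrow> 'a set \<Rightarrow> 'a set \<Rightarrow> 'a set" where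
  "nbs adj V I = {v \<in> V. \<exists>x\<in>I. adj x v}"

definition indep :: "('a \<Rightarrow> 'a \<Rightarrow> bool) \<Rightarrow> 'a set \<Rightarrow> bool" where
  "indep adj I \<longleftrightarrow> (\<forall>x\<in>I. \<forall>y\<in>I. \<not> adj x y)"

text \<open>
  The non-edge \<open>l w\<close> makes the middle vertex of a block unique.
\<close>

definition midpoint :: "('a \<Rightarrow> 'a \<Rightarrow> bool) \<Rightarrow> 'a set set \<Rightarrow> 'a \<Rightarrow> 'a \<Rightarrow> 'a \<Rightarrow> bool" where
  "midpoint adj P v l w \<longleftrightarrow>
     distinct [v, l, w] \<and> {v, l, w} \<in> P \<and> adj v l \<and> adj v w \<and> \<not> adj l w"

text \<open>If \<open>x\<close> is uncovered, putting \<open>x\<close> in place of \<open>y\<close>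
  in the block gives the path \<open>x v w\<close>, and the new packing misses \<open>y\<close>
  instead.\<close>

definition alt_step :: "('a \<Rightarrow> 'a \<Rightarrow> bool) \<Rightarrow> 'a set set \<Rightarrow> 'a \<Rightarrow> 'a \<Rightarrow> bool" where
  "alt_step adj P x y \<longleftrightarrow> (\<exists>v w. midpoint adj P v y w \<and> adj x v)"

section \<open>Exchange and union of packings\<close>

lemma short_path_edge: "a \<noteq> b \<Longrightarrow> adj a b \<Longrightarrow> short_path adj {a, b}"
  unfolding short_path_def by auto

lemma short_path_two_edges:
  "distinct [a, b, c] \<Longrightarrow> adj a b \<Longrightarrow> adj b c \<Longrightarrow> short_path adj {a, b, c}"
  unfolding short_path_def by blast

lemma packing_disjoint:
  assumes "packing adj V P" "B \<in> P" "C \<in> P" "x \<in> B" "x \<in> C"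
  shows "B = C"
  using assms unfolding packing_def pairwise_def disjnt_def by blast

text \<open>The new blocks use only vertices released by \<open>Bs\<close> or missed by
  \<open>P\<close>, so they cannot meet a block that is kept.\<close>

lemma packing_replace:
  assumes "packing adj V P" "packing adj (\<Union>Bs \<union> (V - \<Union>P)) Qs" "Bs \<subseteq> P"
  shows "packing adj V ((P - Bs) \<union> Qs)"
    and "\<Union>((P - Bs) \<union> Qs) = (\<Union>P - \<Union>Bs) \<union> \<Union>Qs"
proof -
  have disj: "\<Union>(P - Bs) \<inter> \<Union>Bs = {}"
    using assms(1,3) packing_disjoint[OF assms(1)] by blast
  then show "\<Union>((P - Bs) \<union> Qs) = (\<Union>P - \<Union>Bs) \<union> \<Union>Qs"
    by blast
  have "\<Union>(P - Bs) \<inter> \<Union>Qs = {}"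
    using assms disj unfolding packing_def by blast
  then have "disjnt B C" if "B \<in> P - Bs" "C \<in> Qs" for B C
    using that unfolding disjnt_def by blast
  then have "pairwise disjnt ((P - Bs) \<union> Qs)"
    using assms unfolding packing_def pairwise_def by (auto simp: disjnt_sym)
  moreover have "\<Union>((P - Bs) \<union> Qs) \<subseteq> V"
    using assms unfolding packing_def by blast
  ultimately show "packing adj V ((P - Bs) \<union> Qs)"
    using assms unfolding packing_def by blast
qed

lemma packing_Un:
  assumes "packing adj V P" "packing adj W Q" "V \<inter> W = {}"
  shows "packing adj (V \<union> W) (P \<union> Q)"
proof -
  have "disjnt B C" if "B \<in> P" "C \<in> Q" for B C
    using that assms unfolding packing_def disjnt_def by blast
  then have "pairwise disjnt (P \<union> Q)"
    using assms unfolding packing_def pairwise_def by (auto simp: disjnt_sym)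
  then show ?thesis
    using assms unfolding packing_def by blast
qed

lemma packing_singleton:
  "short_path adj B \<Longrightarrow> B \<subseteq> V \<Longrightarrow> packing adj V {B}"
  by (simp add: packing_def)

lemma packing_pair:
  "short_path adj B \<Longrightarrow> short_path adj C \<Longrightarrow> B \<inter> C = {} \<Longrightarrow> B \<union> C \<subseteq> V \<Longrightarrow> packing adj V {B, C}"
  by (auto simp: packing_def pairwise_def disjnt_def)

text \<open>Only steps entering a vertex of \<open>xs\<close> have to be transferred. For a path
  without repetitions this excludes steps back into its earlier vertices.\<close>

lemma rtrancl_path_mono_strong:
  assumes "rtrancl_path r x xs y" "\<And>a b. b \<in> set xs \<Longrightarrow> r a b \<Longrightarrow> s a b"
  shows "rtrancl_path s x xs y"
  using assms by (induction) (auto intro: rtrancl_path.intros)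

locale finite_adjacency =
  fixes V :: "'a set" and adj :: "'a \<Rightarrow> 'a \<Rightarrow> bool"
  assumes finite_V: "finite V"
    and adj_sym: "adj x y \<Longrightarrow> adj y x"
    and adj_irrefl: "\<not> adj x x"
begin

definition maximum_packing :: "'a set set \<Rightarrow> bool" where
  "maximum_packing P \<longleftrightarrow>
     packing adj V P \<and> (\<forall>Q. packing adj V Q \<longrightarrow> card (\<Union>Q) \<le> card (\<Union>P))"

lemma maximum_packing_exists: "\<exists>P. maximum_packing P"
proof -
  have "packing adj V {}"
    by (simp add: packing_def)
  moreover have "card (\<Union>Q) \<le> card V" if "packing adj V Q" for Q
    using that finite_V by (auto simp: packing_def intro: card_mono)
  ultimately show ?thesis
    unfolding maximum_packing_def
    using ex_has_greatest_nat[of "packing adj V" "{}" "\<lambda>Q. card (\<Union>Q)" "Suc (card V)"]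
    by (auto simp: less_Suc_eq_le)
qed

text \<open>Trading \<open>Bs\<close> for \<open>Qs\<close> would cover exactly one vertex more,
  namely \<open>u\<close>.\<close>

lemma maximum_packing_no_extension:
  assumes "maximum_packing P" "u \<in> V - \<Union>P" "packing adj (insert u (\<Union>Bs)) Qs" "Bs \<subseteq> P"
  shows "\<Union>Qs \<noteq> insert u (\<Union>Bs)"
proof
  assume eq: "\<Union>Qs = insert u (\<Union>Bs)"
  have P: "packing adj V P"
    using assms(1) by (simp add: maximum_packing_def)
  have "packing adj (\<Union>Bs \<union> (V - \<Union>P)) Qs"
    using assms(2,3) unfolding packing_def by blast
  note R = packing_replace[OF P this assms(4)]
  have "\<Union>((P - Bs) \<union> Qs) = insert u (\<Union>P)"
    using R(2) eq assms(4) by blast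
  moreover have "finite (\<Union>P)"
    using P finite_V finite_subset unfolding packing_def by blast
  ultimately have "card (\<Union>((P - Bs) \<union> Qs)) = Suc (card (\<Union>P))"
    using assms(2) by simp
  then show False
    using R(1) assms(1) unfolding maximum_packing_def by fastforce
qed

section \<open>Uncovered vertices and alternating paths\<close>

text \<open>By disjointness both descriptions concern one block. A middle vertex is adjacent to both
  others, so it cannot be one of two nonadjacent ends.\<close>

lemma midpoint_unique:
  assumes "packing adj V P" "midpoint adj P v l w" "midpoint adj P v' l' w'"
    and "x \<in> {v, l, w}" "x \<in> {v', l', w'}"
  shows "v = v'" "{l, w} = {l', w'}"
proof -
  have eq: "{v, l, w} = {v', l', w'}"
    using assms packing_disjoint[OF assms(1)] unfolding midpoint_def by blast
  show "v = v'"
  proof (rule ccontr)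
    assume "v \<noteq> v'"
    have v: "adj v x" "adj x v" if "x \<in> {v, l, w}" "x \<noteq> v" for x
      using that assms(2) adj_sym by (auto simp: midpoint_def)
    have "v = l' \<or> v = w'"
      using eq \<open>v \<noteq> v'\<close> by blast
    then have "adj l' w'"
      using v[of l'] v[of w'] eq assms(3) by (auto simp: midpoint_def)
    then show False
      using assms(3) by (simp add: midpoint_def)
  qed
  have "{l, w} = {v, l, w} - {v}" "{l', w'} = {v', l', w'} - {v'}"
    using assms(2,3) by (auto simp: midpoint_def)
  then show "{l, w} = {l', w'}"
    using \<open>v = v'\<close> eq by metis
qed

text \<open>Otherwise more vertices could be covered: by the edge \<open>uv\<close> if
  \<open>v\<close> is uncovered, by a path on three vertices if the block of \<open>v\<close> has
  two, and by two disjoint edges if \<open>v\<close> is an end of a longer block or lies in a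
  triangle.\<close>

lemma exposed_neighbour_midpoint:
  assumes max: "maximum_packing P" and u: "u \<in> V - \<Union>P" and v: "v \<in> V" and uv: "adj u v"
  shows "\<exists>l w. midpoint adj P v l w"
proof (rule ccontr)
  assume no_mid: "\<nexists>l w. midpoint adj P v l w"
  have P: "packing adj V P"
    using max by (simp add: maximum_packing_def)
  have "u \<noteq> v"
    using uv adj_irrefl by blast
  show False
  proof (cases "v \<in> \<Union>P")
    case False
    then have "packing adj V ({{u, v}} \<union> P)"
      using P u v uv \<open>u \<noteq> v\<close> short_path_edge[of u v adj]
      unfolding packing_def by (auto simp: pairwise_insert disjnt_def)
    moreover have "card (\<Union>({{u, v}} \<union> P)) > card (\<Union>P)"
    proof (rule psubset_card_mono)
      show "finite (\<Union>({{u, v}} \<union> P))"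
        using calculation finite_V finite_subset unfolding packing_def by blast
    qed (use u in auto)
    ultimately show False
      using max unfolding maximum_packing_def by (meson not_less)
  next
    case True
    then obtain B where B: "B \<in> P" "v \<in> B"
      by blast
    then have "u \<notin> B"
      using u by blast
    have ext: False if "packing adj (insert u B) Qs" "\<Union>Qs = insert u B" for Qs
      using maximum_packing_no_extension[OF max u, of "{B}" Qs] that B by simp
    have long: False if "distinct [v, b, w]" "adj v b" "adj b w" "B = {v, b, w}" for b w
    proof -
      have "packing adj (insert u B) {{u, v}, {b, w}}"
        using that \<open>u \<notin> B\<close> uv by (intro packing_pair short_path_edge) auto
      then show False
        using ext that by auto
    qed
    have "short_path adj B"
      using P B by (auto simp: packing_def)
    then consider (two) a b where "distinct [a, b]" "adj a b" "B = {a, b}"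
      | (three) a b c where "distinct [a, b, c]" "adj a b" "adj b c" "B = {a, b, c}"
      unfolding short_path_def by blast
    then show False
    proof cases
      case two
      then obtain w where w: "B = {v, w}" "v \<noteq> w" "adj v w"
        using B adj_sym by fastforce
      then have "packing adj (insert u B) {{u, v, w}}"
        using uv \<open>u \<notin> B\<close> by (intro packing_singleton short_path_two_edges) auto
      then show False
        using ext w by auto
    next
      case three
      show False
      proof (cases "v = b")
        case True
        show False
        proof (cases "adj a c")
          case True
          then show False
            using long[of a c] three \<open>v = b\<close> adj_sym by (auto simp: insert_commute)
        next
          case False
          then have "midpoint adj P v a c"
            using three B True adj_sym by (auto simp: midpoint_def insert_commute)
          then show False
            using no_mid by blast
        qed
      next
        case False
        then consider "v = a" | "v = c"
          using three B by blast
        then show False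
          using long[of b a] long[of b c] three adj_sym by cases (auto simp: insert_commute)
      qed
    qed
  qed
qed

lemma swap_exposed:
  assumes max: "maximum_packing P" and u: "u \<in> V - \<Union>P"
    and mid: "midpoint adj P v l w" and uv: "adj u v"
  defines "P' \<equiv> (P - {{v, l, w}}) \<union> {{u, v, w}}"
  shows "maximum_packing P'" "l \<in> V - \<Union>P'" "midpoint adj P' v u w"
proof -
  have P: "packing adj V P"
    using max by (simp add: maximum_packing_def)
  have vlw: "distinct [v, l, w]" "{v, l, w} \<in> P" "adj v l" "adj v w"
    using mid by (auto simp: midpoint_def)
  have u_fresh: "u \<notin> {v, l, w}"
    using u vlw by blast
  have sub: "{v, l, w} \<subseteq> V"
    using P vlw unfolding packing_def by blast
  have "packing adj (\<Union>{{v, l, w}} \<union> (V - \<Union>P)) {{u, v, w}}"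
    using vlw u uv u_fresh by (intro packing_singleton short_path_two_edges) auto
  note R = packing_replace[OF P this, folded P'_def]
  have cover: "\<Union>P' = insert u (\<Union>P - {l})"
    using R(2) vlw by auto
  show l: "l \<in> V - \<Union>P'"
    using cover sub u_fresh by auto
  have "finite (\<Union>P)"
    using P finite_V finite_subset unfolding packing_def by blast
  moreover have "l \<in> \<Union>P"
    using vlw by blast
  ultimately have "Suc (card (\<Union>P - {l})) = card (\<Union>P)"
    by (rule card_Suc_Diff1)
  then have "card (\<Union>P') = card (\<Union>P)"
    using cover u \<open>finite (\<Union>P)\<close> by (simp del: Union_iff)
  then show "maximum_packing P'"
    using R(1) vlw max unfolding maximum_packing_def by simp
  \<comment> \<open>Neighbours of \<open>u\<close> are midpoints, so \<open>w\<close> would be a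
    second middle vertex of the block of \<open>v\<close>.\<close>
  have "\<not> adj u w"
  proof
    assume "adj u w"
    then obtain a b where "midpoint adj P w a b"
      using exposed_neighbour_midpoint[OF max u] sub by blast
    then have "w = v"
      using midpoint_unique(1)[OF P _ mid, of w a b w] by blast
    then show False
      using vlw by simp
  qed
  then show "midpoint adj P' v u w"
    using vlw uv u_fresh adj_sym by (auto simp: midpoint_def P'_def insert_commute)
qed

text \<open>
  Swapping along the first step of an alternating path exposes its second vertex in another
  maximum packing; as the path has no repetitions, the rest of it is still alternating there.
\<close>

lemma reached_neighbour_midpoint:
  assumes "rtrancl_path (alt_step adj P) u xs a" "distinct (u # xs)"
    and "maximum_packing P" "u \<in> V - \<Union>P" "v \<in> V" "adj a v"
  shows "\<exists>l w. midpoint adj P v l w"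
  using assms
proof (induction xs arbitrary: P u)
  case Nil
  then have "u = a"
    by (auto elim: rtrancl_path.cases)
  then show ?case
    using Nil exposed_neighbour_midpoint by blast
next
  case (Cons l xs)
  from Cons.prems(1) have "alt_step adj P u l" and path: "rtrancl_path (alt_step adj P) l xs a"
    by (auto elim: rtrancl_path.cases)
  then obtain m w where mid: "midpoint adj P m l w" and um: "adj u m"
    by (auto simp: alt_step_def)
  define P' where "P' = (P - {{m, l, w}}) \<union> {{u, m, w}}"
  note swap = swap_exposed[OF Cons.prems(3,4) mid um, folded P'_def]
  have P: "packing adj V P" and P': "packing adj V P'"
    using Cons.prems(3) swap(1) by (auto simp: maximum_packing_def)
  have "alt_step adj P' x y" if y: "y \<in> set xs" and step: "alt_step adj P x y" for x y
  proof -
    obtain c z where c: "midpoint adj P c y z" "adj x c"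
      using step by (auto simp: alt_step_def)
    show ?thesis
    proof (cases "{c, y, z} = {m, l, w}")
      \<comment> \<open>The swapped block can be entered again only at its other end
        \<open>w\<close>, and there \<open>u\<close> has taken the place of
        \<open>l\<close>.\<close>
      case True
      then have "c = m" "{y, z} = {l, w}"
        using midpoint_unique[OF P c(1) mid, of c] by auto
      moreover have "y \<noteq> l"
        using y Cons.prems(2) by auto
      ultimately have "c = m" "y = w"
        by (auto simp: doubleton_eq_iff)
      then have "midpoint adj P' c y u"
        using swap(3) adj_sym by (auto simp: midpoint_def insert_commute)
      then show ?thesis
        using c(2) by (auto simp: alt_step_def)
    next
      case False
      then have "midpoint adj P' c y z"
        using c(1) by (auto simp: midpoint_def P'_def)
      then show ?thesis
        using c(2) by (auto simp: alt_step_def)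
    qed
  qed
  then have "rtrancl_path (alt_step adj P') l xs a"
    using path by (rule rtrancl_path_mono_strong[rotated])
  then obtain y z where v: "midpoint adj P' v y z"
    using Cons.IH[of P' l] Cons.prems swap by auto
  show ?case
  proof (cases "{v, y, z} = {u, m, w}")
    \<comment> \<open>The one new block of \<open>P'\<close> has the same middle vertex
      \<open>m\<close> as the block it replaced.\<close>
    case True
    then have "v = m"
      using midpoint_unique(1)[OF P' v swap(3), of v] by auto
    then show ?thesis
      using mid by blast
  next
    case False
    then have "midpoint adj P v y z"
      using v by (auto simp: midpoint_def P'_def)
    then show ?thesis
      by blast
  qed
qed

section \<open>A sufficient expansion condition for a factor\<close>

theorem path_factor_from_expansion:
  assumes expansion: "\<And>I. I \<subseteq> V \<Longrightarrow> indep adj I \<Longrightarrow> card I \<le> 2 * card (nbs adj V I)"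
  shows "\<exists>P. packing adj V P \<and> \<Union>P = V"
proof -
  obtain P where max: "maximum_packing P"
    using maximum_packing_exists by blast
  then have P: "packing adj V P"
    by (simp add: maximum_packing_def)
  have "\<Union>P = V"
  proof (rule ccontr)
    assume "\<Union>P \<noteq> V"
    then obtain u where u: "u \<in> V - \<Union>P"
      using P unfolding packing_def by blast
    define R where "R = {a. (alt_step adj P)\<^sup>*\<^sup>* u a}"
    define S where "S = nbs adj V R"
    have uR: "u \<in> R"
      by (simp add: R_def)
    have stepR: "y \<in> R" if "x \<in> R" "adj x v" "midpoint adj P v y w" for x v y w
    proof -
      have "alt_step adj P x y"
        using that by (auto simp: alt_step_def)
      then show ?thesis
        using that(1) by (auto simp: R_def)
    qed
    have mid: "\<exists>l w. midpoint adj P v l w" if v: "v \<in> S" for v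
    proof -
      obtain a where a: "a \<in> R" "adj a v" "v \<in> V"
        using v by (auto simp: S_def nbs_def)
      then obtain ys where "rtrancl_path (alt_step adj P) u ys a"
        unfolding R_def rtranclp_eq_rtrancl_path by blast
      then obtain xs where "rtrancl_path (alt_step adj P) u xs a" "distinct (u # xs)"
        by (rule rtrancl_path_distinct)
      then show ?thesis
        using reached_neighbour_midpoint max u a by blast
    qed
    have leaf: "\<exists>v w. v \<in> S \<and> midpoint adj P v a w" if "a \<in> R" "a \<noteq> u" for a
    proof -
      from that obtain x where x: "x \<in> R" "alt_step adj P x a"
        unfolding R_def by (auto elim: rtranclp.cases)
      then obtain v w where vw: "midpoint adj P v a w" "adj x v"
        by (auto simp: alt_step_def)
      moreover have "v \<in> V"
        using vw P by (auto simp: midpoint_def packing_def)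
      ultimately show ?thesis
        using x by (auto simp: S_def nbs_def)
    qed
    have RV: "R \<subseteq> V"
    proof
      fix a assume "a \<in> R"
      then show "a \<in> V"
        using leaf[of a] u P by (cases "a = u") (auto simp: midpoint_def packing_def)
    qed
    \<comment> \<open>A common vertex would be the middle of its block as a member of
      \<open>S\<close> and an end of it as a member of \<open>R\<close>; the exception
      \<open>u\<close> lies in no block.\<close>
    have "R \<inter> S = {}"
    proof (rule ccontr)
      assume "R \<inter> S \<noteq> {}"
      then obtain a where a: "a \<in> R" "a \<in> S"
        by blast
      obtain l w where lw: "midpoint adj P a l w"
        using mid a by blast
      then have "a \<noteq> u"
        using u by (auto simp: midpoint_def)
      then obtain v z where "midpoint adj P v a z"
        using leaf a by blast
      moreover from this have "a = v"
        using midpoint_unique(1)[OF P lw, of v a z a] by auto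
      ultimately show False
        by (simp add: midpoint_def)
    qed
    then have "indep adj R"
      using RV unfolding indep_def S_def nbs_def by blast
    obtain l w where lw: "\<And>v. v \<in> S \<Longrightarrow> midpoint adj P v (l v) (w v)"
      using mid by metis
    have "finite S"
      using finite_V by (simp add: S_def nbs_def)
    have "card (\<Union>v\<in>S. {l v, w v}) = (\<Sum>v\<in>S. card {l v, w v})"
    proof (rule card_UN_disjoint[OF \<open>finite S\<close>])
      show "\<forall>v\<in>S. \<forall>v'\<in>S. v \<noteq> v' \<longrightarrow> {l v, w v} \<inter> {l v', w v'} = {}"
        using midpoint_unique(1)[OF P lw lw] by blast
    qed simp
    also have "\<dots> = (\<Sum>v\<in>S. 2)"
      using lw by (intro sum.cong) (auto simp: midpoint_def card_insert_if)
    finally have card_leaves: "card (\<Union>v\<in>S. {l v, w v}) = 2 * card S"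
      by simp
    have "insert u (\<Union>v\<in>S. {l v, w v}) \<subseteq> R"
    proof -
      have "l v \<in> R \<and> w v \<in> R" if v: "v \<in> S" for v
      proof -
        obtain x where "x \<in> R" "adj x v"
          using v by (auto simp: S_def nbs_def)
        moreover have "midpoint adj P v (w v) (l v)"
          using lw[OF v] adj_sym by (auto simp: midpoint_def insert_commute)
        ultimately show ?thesis
          using stepR lw[OF v] by blast
      qed
      then show ?thesis
        using uR by blast
    qed
    \<comment> \<open>The uncovered vertex \<open>u\<close> is the one element of \<open>R\<close>
      beyond the two ends per midpoint that breaks the expansion condition.\<close>
    moreover have "u \<notin> (\<Union>v\<in>S. {l v, w v})"
      using u lw unfolding midpoint_def by blast
    ultimately have "Suc (2 * card S) \<le> card R"
      using card_leaves \<open>finite S\<close> card_mono[of R "insert u (\<Union>v\<in>S. {l v, w v})"]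
        finite_subset[OF RV finite_V] by simp
    then show False
      using expansion[OF RV \<open>indep adj R\<close>] by (simp add: S_def)
  qed
  then show ?thesis
    using P by blast
qed

end

section \<open>Minimum degree and excluded stars\<close>

text \<open>An excluded star appears as a bound on independent sets of neighbours. The last
  assumption is \<open>d \<ge> \<lceil>r/2\<rceil> + 1\<close> cleared of fraction and
  rounding.\<close>

locale star_free_adjacency = finite_adjacency +
  fixes d r :: nat
  assumes degree: "v \<in> V \<Longrightarrow> d \<le> card (nbs adj V {v})"
    and star: "\<lbrakk>v \<in> V; L \<subseteq> V; indep adj L; \<forall>x\<in>L. adj v x\<rbrakk> \<Longrightarrow> card L < r"
    and degree_large: "r + 2 \<le> 2 * d"
begin

lemma finite_adjacency_finite: "finite W \<Longrightarrow> finite_adjacency W adj"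
  using adj_sym adj_irrefl by (intro finite_adjacency.intro)

text \<open>
  Double count the edges between \<open>I\<close> and \<open>T\<close>: a vertex of \<open>T\<close> has at most
  \<open>r - 1 \<le> 2 d - 3\<close> neighbours in \<open>I\<close>. Subtraction is avoided by moving the 3 to the left.
\<close>

lemma independent_count:
  assumes "I \<subseteq> V" "indep adj I" "T \<subseteq> V" "nbs adj V I \<subseteq> T"
  shows "d * card I + 3 * card T \<le> 2 * d * card T"
proof -
  have fin: "finite I" "finite T"
    using finite_subset[OF assms(1) finite_V] finite_subset[OF assms(3) finite_V] .
  have T: "card {x\<in>I. adj x t} + 3 \<le> 2 * d" if "t \<in> T" for t
  proof -
    have "card {x\<in>I. adj x t} < r"
      using that assms adj_sym by (intro star[of t]) (auto simp: indep_def)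
    then show ?thesis
      using degree_large by simp
  qed
  have "d * card I = (\<Sum>x\<in>I. d)"
    by simp
  also have "\<dots> \<le> (\<Sum>x\<in>I. card {t\<in>T. adj x t})"
  proof (rule sum_mono)
    fix x assume x: "x \<in> I"
    have "nbs adj V {x} \<subseteq> {t\<in>T. adj x t}"
      using x assms(4) by (auto simp: nbs_def)
    then have "card (nbs adj V {x}) \<le> card {t\<in>T. adj x t}"
      using fin by (intro card_mono) auto
    then show "d \<le> card {t\<in>T. adj x t}"
      using degree[of x] x assms(1) by auto
  qed
  also have "\<dots> = (\<Sum>t\<in>T. card {x\<in>I. adj x t})"
    using fin by (intro sum_multicount_gen) auto
  finally have "d * card I + 3 * card T \<le> (\<Sum>t\<in>T. card {x\<in>I. adj x t} + 3)"
    by (simp add: sum.distrib)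
  also have "\<dots> \<le> (\<Sum>t\<in>T. 2 * d)"
    by (intro sum_mono T)
  finally show ?thesis
    by (simp add: mult.commute)
qed

text \<open>All neighbours of a subset of \<open>W\<close> lie in \<open>W\<close>, so the double
  count applies with \<open>T\<close> the neighbourhood inside \<open>W\<close>. Dropping the term
  \<open>3 * card T\<close> and cancelling the positive \<open>d\<close> gives expansion.\<close>

lemma packing_of_closed_set:
  assumes "W \<subseteq> V" and closed: "\<And>v w. v \<in> W \<Longrightarrow> w \<in> V \<Longrightarrow> adj v w \<Longrightarrow> w \<in> W"
  shows "\<exists>P. packing adj W P \<and> \<Union>P = W"
proof -
  interpret W: finite_adjacency W adj
    by (rule finite_adjacency_finite[OF finite_subset[OF assms(1) finite_V]])
  show ?thesis
  proof (rule W.path_factor_from_expansion)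
    fix I assume I: "I \<subseteq> W" "indep adj I"
    have "nbs adj V I \<subseteq> nbs adj W I" "nbs adj W I \<subseteq> V"
      using I assms closed by (auto simp: nbs_def)
    then have "d * card I + 3 * card (nbs adj W I) \<le> 2 * d * card (nbs adj W I)"
      using I assms(1) by (intro independent_count) auto
    then have "d * card I \<le> d * (2 * card (nbs adj W I))"
      by (simp only: mult.assoc mult.left_commute[of 2 d])
    then show "card I \<le> 2 * card (nbs adj W I)"
      using degree_large by simp
  qed
qed

text \<open>A nonempty independent set lies on one side and has the whole other side as neighbours,
  so the ratio of the sides gives expansion.\<close>

lemma packing_of_complete_join:
  assumes "finite I" "finite T" "card I = 2 * card T" "I \<inter> T = {}"
    and join: "\<And>i t. i \<in> I \<Longrightarrow> t \<in> T \<Longrightarrow> adj i t"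
  shows "\<exists>P. packing adj (I \<union> T) P \<and> \<Union>P = I \<union> T"
proof -
  interpret IT: finite_adjacency "I \<union> T" adj
    using assms(1,2) by (intro finite_adjacency_finite) simp
  show ?thesis
  proof (rule IT.path_factor_from_expansion)
    fix J assume J: "J \<subseteq> I \<union> T" "indep adj J"
    have fin: "finite (nbs adj (I \<union> T) J)"
      using assms by (simp add: nbs_def)
    consider "J = {}" | "J \<inter> I \<noteq> {}" "J \<subseteq> I" | "J \<inter> T \<noteq> {}" "J \<subseteq> T"
      using J join unfolding indep_def by blast
    then show "card J \<le> 2 * card (nbs adj (I \<union> T) J)"
    proof cases
      case 1
      then show ?thesis by simp
    next
      case 2
      then have "T \<subseteq> nbs adj (I \<union> T) J"
        using join by (auto simp: nbs_def)
      then show ?thesis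
        using card_mono[OF fin, of T] card_mono[OF assms(1) 2(2)] assms(3) by linarith
    next
      case 3
      then have "I \<subseteq> nbs adj (I \<union> T) J"
        using join[THEN adj_sym] by (fastforce simp: nbs_def)
      then show ?thesis
        using card_mono[OF fin, of I] card_mono[OF assms(2) 3(2)] assms(3) by linarith
    qed
  qed
qed

section \<open>Packings through a prescribed edge\<close>

text \<open>Naming \<open>z\<close> as a neighbour of \<open>y\<close> ensures that
  \<open>xy\<close> can be an edge of the path; a block containing \<open>x\<close> and
  \<open>y\<close> could otherwise have them as its two ends.\<close>

theorem packing_through_edge:
  assumes xy: "x \<in> V" "y \<in> V" "adj x y"
  shows "\<exists>P. packing adj V P \<and> \<Union>P = V \<and>
           ({x, y} \<in> P \<or> (\<exists>z. distinct [x, y, z] \<and> adj y z \<and> {x, y, z} \<in> P))"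
proof -
  define V' where "V' = V - {x, y}"
  have "x \<noteq> y"
    using xy adj_irrefl by blast
  interpret V': finite_adjacency V' adj
    using finite_V by (intro finite_adjacency_finite) (simp add: V'_def)
  show ?thesis
  proof (cases "\<forall>I \<subseteq> V'. indep adj I \<longrightarrow> card I \<le> 2 * card (nbs adj V' I)")
    case True
    then obtain P where P: "packing adj V' P" "\<Union>P = V'"
      using V'.path_factor_from_expansion by blast
    have "packing adj ({x, y} \<union> V') ({{x, y}} \<union> P)"
      using P xy \<open>x \<noteq> y\<close>
      by (intro packing_Un packing_singleton short_path_edge) (auto simp: V'_def)
    moreover have "{x, y} \<union> V' = V"
      using xy by (auto simp: V'_def)
    ultimately show ?thesis
      using P by (intro exI[of _ "{{x, y}} \<union> P"]) auto
  next
    case False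
    then obtain I where I: "I \<subseteq> V'" "indep adj I" and large: "card I > 2 * card (nbs adj V' I)"
      by auto
    define T where "T = nbs adj V' I"
    have IV: "I \<subseteq> V" and TV: "T \<union> {x, y} \<subseteq> V"
      using I xy by (auto simp: T_def V'_def nbs_def)
    have fin: "finite I" "finite T"
      using IV TV finite_V by (auto intro: finite_subset)
    have cardT: "card (T \<union> {x, y}) = card T + 2"
      using fin \<open>x \<noteq> y\<close> by (subst card_Un_disjoint) (auto simp: T_def V'_def nbs_def)
    have nbsI: "nbs adj V {i} \<subseteq> T \<union> {x, y}" if "i \<in> I" for i
      using that by (auto simp: T_def V'_def nbs_def)
    have "I \<noteq> {}"
      using large by auto
    then obtain z where z: "z \<in> I"
      by blast
    have "card (nbs adj V {z}) \<le> card T + 2"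
      using card_mono[OF _ nbsI[OF z]] fin cardT by simp
    then have d_le: "d \<le> card T + 2"
      using degree[of z] z IV by auto
    have "nbs adj V I \<subseteq> T \<union> {x, y}"
      by (auto simp: T_def V'_def nbs_def)
    then have count: "d * card I + 3 * (card T + 2) \<le> 2 * d * (card T + 2)"
      using independent_count[OF IV I(2) TV] cardT by simp
    \<comment> \<open>Inserted into \<open>count\<close>, this cancels down to
      \<open>3 * (card T + 2) \<le> 3 * d\<close>, the converse of \<open>d_le\<close>.\<close>
    have "d * (2 * card T + 1) \<le> d * card I"
      using large by (intro mult_le_mono2) (simp add: T_def)
    \<comment> \<open>Everything is tight: \<open>I\<close> is completely joined to \<open>T \<union> {x, y}\<close>.\<close>
    then have d: "d = card T + 2"
      using count d_le by (simp add: algebra_simps)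
    \<comment> \<open>With \<open>d = card T + 2\<close> the count would read
      \<open>d * (2 * card T + 5) \<le> d * (2 * card T + 4)\<close>.\<close>
    have "\<not> 2 * card T + 2 \<le> card I"
    proof
      assume "2 * card T + 2 \<le> card I"
      then have "d * (2 * card T + 2) \<le> d * card I"
        by (rule mult_le_mono2)
      then show False
        using count d by (simp add: algebra_simps)
    qed
    then have cardI: "card I = 2 * card T + 1"
      using large by (simp add: T_def)
    have join: "adj i t" if "i \<in> I" "t \<in> T \<union> {x, y}" for i t
    proof -
      have "nbs adj V {i} = T \<union> {x, y}"
        using nbsI[OF that(1)] fin cardT d degree[of i] that(1) IV by (intro card_seteq) auto
      then show ?thesis
        using that by (auto simp: nbs_def)
    qed
    define W where "W = V - (I \<union> T \<union> {x, y})"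
    \<comment> \<open>\<open>card I \<ge> r - 1\<close>, so a further neighbour outside would complete an induced star.\<close>
    have "\<not> adj v w" if v: "v \<in> I \<union> T \<union> {x, y}" and w: "w \<in> W" for v w
    proof
      assume vw: "adj v w"
      have wI: "\<not> adj i w" "\<not> adj w i" if "i \<in> I" for i
        using that w adj_sym by (auto simp: W_def T_def V'_def nbs_def)
      then have v: "v \<in> T \<union> {x, y}"
        using v vw by blast
      have "card (insert w I) < r"
      proof (rule star)
        show "v \<in> V" "insert w I \<subseteq> V"
          using v TV IV w by (auto simp: W_def)
        show "indep adj (insert w I)"
          using I(2) wI adj_irrefl by (auto simp: indep_def)
        show "\<forall>x\<in>insert w I. adj v x"
          using v vw join adj_sym by auto
      qed
      moreover have "card (insert w I) = 2 * card T + 2"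
        using w fin cardI by (simp add: W_def)
      ultimately show False
        using degree_large d by simp
    qed
    then have "\<exists>P. packing adj W P \<and> \<Union>P = W"
      using adj_sym by (intro packing_of_closed_set) (auto simp: W_def)
    then obtain P where P: "packing adj W P" "\<Union>P = W"
      by blast
    have disj: "I \<inter> (T \<union> {x, y}) = {}"
      using join adj_irrefl I(2) by (auto simp: indep_def)
    \<comment> \<open>The path \<open>x y z\<close> absorbs the surplus vertex of \<open>I\<close>,
      leaving exactly the ratio 2 for the complete join.\<close>
    have "card (I - {z}) = 2 * card T"
      using z cardI fin by simp
    then have "\<exists>Q. packing adj (I - {z} \<union> T) Q \<and> \<Union>Q = I - {z} \<union> T"
      using fin disj join by (intro packing_of_complete_join) auto
    then obtain Q where Q: "packing adj (I - {z} \<union> T) Q" "\<Union>Q = I - {z} \<union> T"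
      by blast
    have xyz: "distinct [x, y, z]" "adj y z"
      using disj z \<open>x \<noteq> y\<close> join adj_sym by auto
    have "{x, y} \<inter> T = {}"
      by (auto simp: T_def V'_def nbs_def)
    then have "packing adj (({x, y, z} \<union> (I - {z} \<union> T)) \<union> W) (({{x, y, z}} \<union> Q) \<union> P)"
      using P(1) Q(1) xyz xy disj z
      by (intro packing_Un packing_singleton short_path_two_edges) (auto simp: W_def)
    moreover have "({x, y, z} \<union> (I - {z} \<union> T)) \<union> W = V"
      using z IV TV by (auto simp: W_def)
    moreover have "\<Union>(({{x, y, z}} \<union> Q) \<union> P) = ({x, y, z} \<union> (I - {z} \<union> T)) \<union> W"
      using P(2) Q(2) by simp
    ultimately show ?thesis
      using xyz by (intro exI[of _ "({{x, y, z}} \<union> Q) \<union> P"]) auto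
  qed
qed

end

section \<open>Path factors of digraphs\<close>

text \<open>The numbering orders a block along a path, starting at 0 as in
  \<open>path_graph\<close>. Other edges inside the block are permitted and will be
  discarded.\<close>

definition path_numbering :: "('a \<Rightarrow> 'a \<Rightarrow> bool) \<Rightarrow> 'a set \<Rightarrow> nat \<Rightarrow> ('a \<Rightarrow> nat) \<Rightarrow> bool" where
  "path_numbering adj B k f \<longleftrightarrow>
     bij_betw f B {0..<k} \<and> (\<forall>u\<in>B. \<forall>v\<in>B. f v = Suc (f u) \<longrightarrow> adj u v)"

text \<open>The second conclusion is what puts the edge \<open>xy\<close> itself into the
  factor.\<close>

lemma path_numbering_edge:
  assumes "x \<noteq> y" "adj x y"
  shows "\<exists>f. path_numbering adj {x, y} 2 f \<and> f y = Suc (f x)"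
proof -
  define f where "f = (\<lambda>v. if v = x then 0 else 1 :: nat)"
  have "f ` {x, y} = {0..<2}"
    using assms by (auto simp: f_def numeral_2_eq_2 atLeast0_lessThan_Suc)
  then have "path_numbering adj {x, y} 2 f \<and> f y = Suc (f x)"
    using assms by (auto simp: path_numbering_def bij_betw_def inj_on_def f_def)
  then show ?thesis
    by blast
qed

lemma path_numbering_two_edges:
  assumes "distinct [x, y, z]" "adj x y" "adj y z"
  shows "\<exists>f. path_numbering adj {x, y, z} 3 f \<and> f y = Suc (f x)"
proof -
  define f where "f = (\<lambda>v. if v = x then 0 else if v = y then 1 else 2 :: nat)"
  have "f ` {x, y, z} = {0..<3}"
    using assms by (auto simp: f_def numeral_3_eq_3 atLeast0_lessThan_Suc)
  then have "path_numbering adj {x, y, z} 3 f \<and> f y = Suc (f x)"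
    using assms by (auto simp: path_numbering_def bij_betw_def inj_on_def f_def)
  then show ?thesis
    by blast
qed

lemma short_path_numbering:
  "short_path adj B \<Longrightarrow> \<exists>k\<in>{2, 3}. \<exists>f. path_numbering adj B k f"
  unfolding short_path_def
proof (elim disjE exE conjE)
  fix a b assume "distinct [a, b]" "adj a b" "B = {a, b}"
  then show ?thesis
    using path_numbering_edge[of a b adj] by auto
next
  fix a b c assume "distinct [a, b, c]" "adj a b" "adj b c" "B = {a, b, c}"
  then show ?thesis
    using path_numbering_two_edges[of a b c adj] by blast
qed

section \<open>From numbered blocks to components\<close>

text \<open>Without parallel arcs an arc is determined by its ends, so the vertex bijection
  \<open>f\<close> also induces an injective map on arcs.\<close>

lemma digraph_iso_path_graph:
  assumes "nomulti_digraph H" and bij: "bij_betw f (verts H) {0..<k}"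
    and ends: "arcs_ends H = {(u, v). u \<in> verts H \<and> v \<in> verts H \<and> (f v = Suc (f u) \<or> f u = Suc (f v))}"
  shows "digraph_iso H (with_proj (path_graph k))"
proof -
  interpret H: nomulti_digraph H by fact
  define \<phi> where "\<phi> = \<lparr>iso_verts = f, iso_arcs = (\<lambda>e. (f (tail H e), f (head H e))),
    iso_head = snd, iso_tail = fst\<rparr>"
  have inj: "inj_on f (verts H)" and img: "f ` verts H = {0..<k}"
    using bij by (auto simp: bij_betw_def)
  have "inj_on (\<lambda>e. (f (tail H e), f (head H e))) (arcs H)"
    using inj by (intro inj_onI H.no_multi_arcs) (auto simp: arc_to_ends_def dest: inj_onD)
  then have "pre_digraph.digraph_isomorphism H \<phi>"
    using inj H.wf_digraph by (simp add: pre_digraph.digraph_isomorphism_def \<phi>_def)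
  moreover have "parcs (path_graph k) = (\<lambda>(u, v). (f u, f v)) ` arcs_ends H"
  proof (intro equalityI subsetI)
    fix e assume "e \<in> parcs (path_graph k)"
    then obtain i j where e: "e = (i, j)" "i < k" "j < k" "j = Suc i \<or> i = Suc j"
      by (auto simp: path_graph_def)
    then have "i \<in> f ` verts H" "j \<in> f ` verts H"
      using img by auto
    then obtain u v where "u \<in> verts H" "v \<in> verts H" "f u = i" "f v = j"
      by blast
    then show "e \<in> (\<lambda>(u, v). (f u, f v)) ` arcs_ends H"
      using e by (intro image_eqI[of _ _ "(u, v)"]) (auto simp: ends)
  next
    fix e assume "e \<in> (\<lambda>(u, v). (f u, f v)) ` arcs_ends H"
    then obtain u v where "u \<in> verts H" "v \<in> verts H" "e = (f u, f v)"
        "f v = Suc (f u) \<or> f u = Suc (f v)"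
      by (auto simp: ends)
    moreover from this have "f u \<in> {0..<k}" "f v \<in> {0..<k}"
      using img by blast+
    ultimately show "e \<in> parcs (path_graph k)"
      by (auto simp: path_graph_def)
  qed
  then have "with_proj (path_graph k) = app_iso \<phi> H"
    using img
    by (intro pre_digraph.equality) (auto simp: \<phi>_def path_graph_def arcs_ends_conv image_image)
  ultimately show ?thesis
    unfolding digraph_iso_def by blast
qed

text \<open>\<open>F\<close> keeps the arcs between consecutive vertices of a common block. Walks in
  \<open>F\<close> cannot leave a block and connect all of it, so the components are the
  blocks.\<close>

lemma (in graph) path_factor_of_numbered_partition:
  assumes disj: "pairwise disjnt P" and cover: "\<Union>P = verts G"
    and num: "\<And>B. B \<in> P \<Longrightarrow> k B \<in> K \<and> path_numbering (dominates G) B (k B) (f B)"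
  defines "E \<equiv> {(u, v). \<exists>B\<in>P. u \<in> B \<and> v \<in> B \<and> (f B v = Suc (f B u) \<or> f B u = Suc (f B v))}"
  defines "F \<equiv> \<lparr>verts = verts G, arcs = {e \<in> arcs G. (tail G e, head G e) \<in> E},
    tail = tail G, head = head G\<rparr>"
  shows "path_factor K F G"
proof -
  have block_unique: "B = B'" if "B \<in> P" "B' \<in> P" "x \<in> B" "x \<in> B'" for B B' x
    using that disj unfolding pairwise_def disjnt_def by blast
  have F_simps [simp]: "verts F = verts G" "tail F = tail G" "head F = head G"
    by (simp_all add: F_def)
  have "sym E"
    by (auto simp: sym_def E_def)
  have "E \<subseteq> arcs_ends G"
    using num graph_symmetric unfolding E_def path_numbering_def by blast
  then have ends: "arcs_ends F = E"
    by (fastforce simp: arcs_ends_conv F_def)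
  have "wf_digraph F"
    by unfold_locales (auto simp: F_def)
  then have sub: "subgraph F G"
    using wf_digraph by (auto simp: subgraph_def F_def compatible_def)
  then have "digraph F"
    by (rule digraph_subgraph)
  then interpret F: digraph F .
  have "symmetric F"
    using \<open>sym E\<close> by (simp add: symmetric_def ends)
  then interpret F: graph F
    by (rule F.graphI)
  have inside: "v \<in> B" if "u \<rightarrow>\<^sup>*\<^bsub>F\<^esub> v" "u \<in> B" "B \<in> P" for u v B
    using that
  proof (induction rule: F.reachable_induct)
    case (step x y)
    then show ?case
      using block_unique[of B _ x] unfolding ends E_def by blast
  qed simp
  have across: "u \<rightarrow>\<^sup>*\<^bsub>F\<^esub> v" if B: "B \<in> P" and uv: "u \<in> B" "v \<in> B" for u v B
  proof -
    have img: "f B ` B = {0..<k B}"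
      using num[OF B] by (auto simp: path_numbering_def bij_betw_def)
    have inj: "inj_on (f B) B"
      using num[OF B] by (auto simp: path_numbering_def bij_betw_def)
    have BV: "B \<subseteq> verts F"
      using B cover by auto
    \<comment> \<open>The values of \<open>f B\<close> fill an initial segment, so the vertex just
      before \<open>b\<close> exists; induction on the gap \<open>n\<close> then walks
      upwards.\<close>
    have up: "a \<rightarrow>\<^sup>*\<^bsub>F\<^esub> b" if "a \<in> B" "b \<in> B" "f B b = f B a + n" for a b n
      using that(2,3)
    proof (induction n arbitrary: b)
      case 0
      then have "b = a"
        using inj_onD[OF inj, of b a] that(1) by simp
      then show ?case
        using that(1) BV by blast
    next
      case (Suc n)
      have "f B b \<in> f B ` B"
        using Suc.prems by blast
      then have "f B a + n \<in> f B ` B"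
        using Suc.prems img by auto
      then obtain c where c: "c \<in> B" "f B c = f B a + n"
        by (metis imageE)
      then have "c \<rightarrow>\<^bsub>F\<^esub> b"
        using Suc.prems B unfolding ends E_def by fastforce
      then show ?case
        using Suc.IH[OF c] F.reachable_adj_trans by blast
    qed
    show ?thesis
    proof (cases "f B u \<le> f B v")
      case True
      then show ?thesis
        using up[OF uv, of "f B v - f B u"] by simp
    next
      case False
      then have "v \<rightarrow>\<^sup>*\<^bsub>F\<^esub> u"
        using up[OF uv(2,1), of "f B u - f B v"] by simp
      then show ?thesis
        by (rule F.symmetric_reachable')
    qed
  qed
  have "\<exists>k\<in>K. digraph_iso C (with_proj (path_graph k))" if C: "C \<in> F.sccs" for C
  proof -
    have "verts C \<in> F.sccs_verts"
      using C F.in_sccs_vertsI_sccs by blast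
    then have ne: "verts C \<noteq> {}"
      and conn: "\<And>u v. u \<in> verts C \<Longrightarrow> v \<in> verts C \<Longrightarrow> u \<rightarrow>\<^sup>*\<^bsub>F\<^esub> v"
      and max: "\<And>u v. u \<in> verts C \<Longrightarrow> u \<rightarrow>\<^sup>*\<^bsub>F\<^esub> v \<Longrightarrow> v \<rightarrow>\<^sup>*\<^bsub>F\<^esub> u \<Longrightarrow> v \<in> verts C"
      unfolding F.in_sccs_verts_conv_reachable by blast+
    have ind: "induced_subgraph C F"
      using C by (rule F.in_sccs_imp_induced)
    then have "verts C \<subseteq> verts G"
      by (auto simp: induced_subgraph_def subgraph_def)
    then obtain u B where u: "u \<in> verts C" "u \<in> B" "B \<in> P"
      using ne cover by blast
    have CB: "verts C = B"
    proof (intro equalityI subsetI)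
      show "v \<in> B" if "v \<in> verts C" for v
        using inside conn[OF u(1) that] u by blast
      show "v \<in> verts C" if "v \<in> B" for v
        using max[OF u(1)] across[OF u(3)] that u(2) by blast
    qed
    have "arcs_ends C = {(u, v) \<in> arcs_ends F. u \<in> B \<and> v \<in> B}"
      using ind CB by (auto simp: arcs_ends_conv induced_subgraph_def subgraph_def compatible_def)
    also have "\<dots> = {(u, v). u \<in> B \<and> v \<in> B \<and> (f B v = Suc (f B u) \<or> f B u = Suc (f B v))}"
      using u(3) block_unique unfolding ends E_def by blast
    finally have "digraph_iso C (with_proj (path_graph (k B)))"
      using F.digraphI_induced[OF ind] num[OF u(3)]
      by (intro digraph_iso_path_graph[of C "f B"])
        (auto simp: CB path_numbering_def digraph_def)
    then show ?thesis
      using num[OF u(3)] by blast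
  qed
  then show ?thesis
    using sub F.graph_axioms by (auto simp: path_factor_def spanning_def)
qed

section \<open>Translating the hypotheses and assembling the factor\<close>

text \<open>Any \<open>r\<close> of the independent neighbours induce, together with
  \<open>v\<close>, a forbidden star.\<close>

lemma (in graph) star_free_independent_neighbours:
  assumes "star_free r G" "v \<in> verts G" "L \<subseteq> verts G" "indep (dominates G) L"
    and adj: "\<forall>x\<in>L. v \<rightarrow>\<^bsub>G\<^esub> x"
  shows "card L < r"
proof (rule ccontr)
  assume "\<not> card L < r"
  then obtain M where M: "M \<subseteq> L" "card M = r"
    by (meson not_less obtain_subset_with_card_n)
  define H where "H = G \<restriction> insert v M"
  have ind: "induced_subgraph H G"
    unfolding H_def using M assms by (intro induced_induce) auto
  have "v \<notin> M"
    using M adj adj_not_same by blast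
  have "arcs_ends H = {(a, b) \<in> arcs_ends G. a \<in> insert v M \<and> b \<in> insert v M}"
    by (auto simp: H_def arcs_ends_conv)
  also have "\<dots> = {v} \<times> M \<union> M \<times> {v}"
  proof -
    have "v \<rightarrow>\<^bsub>G\<^esub> x" "x \<rightarrow>\<^bsub>G\<^esub> v" if "x \<in> M" for x
      using that M(1) adj graph_symmetric by blast+
    moreover have "\<not> x \<rightarrow>\<^bsub>G\<^esub> y" if "x \<in> M" "y \<in> M" for x y
      using that M(1) assms(4) unfolding indep_def by blast
    moreover have "\<not> v \<rightarrow>\<^bsub>G\<^esub> v"
      using adj_not_same by blast
    ultimately show ?thesis
      by blast
  qed
  finally have ends: "arcs_ends H = {v} \<times> M \<union> M \<times> {v}" .
  interpret H: digraph H
    using ind by (rule digraphI_induced)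
  have "graph H"
    by (intro H.graphI) (auto simp: symmetric_def sym_def ends)
  moreover have "verts H = {v} \<union> M" "{v} \<inter> M = {}" "card {v} = 1"
    using \<open>v \<notin> M\<close> by (auto simp: H_def)
  ultimately have "complete_bipartite_digraph 1 r H"
    using M(2) ends unfolding complete_bipartite_digraph_def by blast
  then show False
    using assms(1) ind by (auto simp: star_free_def)
qed

lemma (in graph) out_degree_eq_card_nbs:
  "out_degree G v = card (nbs (dominates G) (verts G) {v})"
proof -
  have "inj_on (head G) (out_arcs G v)"
    by (intro inj_onI no_multi_arcs) (auto simp: arc_to_ends_def)
  moreover have "head G ` out_arcs G v = nbs (dominates G) (verts G) {v}"
    by (auto simp: nbs_def arcs_ends_conv)
  ultimately show ?thesis
    unfolding out_degree_def by (metis card_image)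
qed

theorem theorem11:
  fixes G :: "('a,'b) pre_digraph" and r :: nat
  assumes "r \<ge> 3"
    and "graph G"
    and "star_free r G"
    and "int (min_degree G) \<ge> \<lceil>real r / 2\<rceil> + 1"
  shows "path_factor_covered {2, 3} G"
  unfolding path_factor_covered_def
proof
  fix e assume e: "e \<in> arcs G"
  interpret graph G by fact
  interpret star_free_adjacency "verts G" "dominates G" "min_degree G" r
  proof
    show "finite (verts G)"
      by simp
    show "u \<rightarrow>\<^bsub>G\<^esub> v \<Longrightarrow> v \<rightarrow>\<^bsub>G\<^esub> u" for u v
      by (rule graph_symmetric)
    show "\<not> v \<rightarrow>\<^bsub>G\<^esub> v" for v
      using adj_not_same by blast
    show "min_degree G \<le> card (nbs (dominates G) (verts G) {v})" if "v \<in> verts G" for v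
      using that by (simp add: min_degree_def flip: out_degree_eq_card_nbs)
    show "card L < r"
      if "v \<in> verts G" "L \<subseteq> verts G" "indep (dominates G) L" "\<forall>x\<in>L. v \<rightarrow>\<^bsub>G\<^esub> x" for v L
      using star_free_independent_neighbours[OF assms(3) that] .
    show "r + 2 \<le> 2 * min_degree G"
      using assms(4) by linarith
  qed
  let ?x = "tail G e" and ?y = "head G e"
  have xy: "?x \<rightarrow>\<^bsub>G\<^esub> ?y"
    using e by (auto simp: arcs_ends_conv)
  then obtain P where P: "packing (dominates G) (verts G) P" "\<Union>P = verts G"
    and edge: "{?x, ?y} \<in> P \<or> (\<exists>z. distinct [?x, ?y, z] \<and> ?y \<rightarrow>\<^bsub>G\<^esub> z \<and> {?x, ?y, z} \<in> P)"
    using packing_through_edge[of ?x ?y] e by auto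
  have "?x \<noteq> ?y"
    using e by (rule no_loops)
  have "\<exists>B0\<in>P. \<exists>k0\<in>{2, 3}. \<exists>f0. ?x \<in> B0 \<and> ?y \<in> B0 \<and>
      path_numbering (dominates G) B0 k0 f0 \<and> f0 ?y = Suc (f0 ?x)"
    using edge
  proof
    assume "{?x, ?y} \<in> P"
    moreover obtain f where "path_numbering (dominates G) {?x, ?y} 2 f" "f ?y = Suc (f ?x)"
      using path_numbering_edge[of ?x ?y "dominates G"] xy \<open>?x \<noteq> ?y\<close> by blast
    ultimately show ?thesis
      by (intro bexI[of _ "{?x, ?y}"] bexI[of _ 2] exI[of _ f]) auto
  next
    assume "\<exists>z. distinct [?x, ?y, z] \<and> ?y \<rightarrow>\<^bsub>G\<^esub> z \<and> {?x, ?y, z} \<in> P"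
    then obtain z where z: "distinct [?x, ?y, z]" "?y \<rightarrow>\<^bsub>G\<^esub> z" "{?x, ?y, z} \<in> P"
      by blast
    moreover obtain f where "path_numbering (dominates G) {?x, ?y, z} 3 f" "f ?y = Suc (f ?x)"
      using path_numbering_two_edges[of ?x ?y z "dominates G"] xy z by blast
    ultimately show ?thesis
      by (intro bexI[of _ "{?x, ?y, z}"] bexI[of _ 3] exI[of _ f]) auto
  qed
  then obtain B0 k0 f0 where B0: "B0 \<in> P" "?x \<in> B0" "?y \<in> B0"
    and num0: "k0 \<in> {2, 3}" "path_numbering (dominates G) B0 k0 f0" "f0 ?y = Suc (f0 ?x)"
    by blast
  have "\<forall>B\<in>P. \<exists>kf. fst kf \<in> {2, 3} \<and> path_numbering (dominates G) B (fst kf) (snd kf)"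
  proof
    fix B assume "B \<in> P"
    then have "short_path (dominates G) B"
      using P(1) by (simp add: packing_def)
    from short_path_numbering[OF this]
    obtain k f where "k \<in> {2, 3}" "path_numbering (dominates G) B k f"
      by (elim bexE exE)
    then show "\<exists>kf. fst kf \<in> {2, 3} \<and> path_numbering (dominates G) B (fst kf) (snd kf)"
      by (intro exI[of _ "(k, f)"]) simp
  qed
  then obtain kf where kf: "\<And>B. B \<in> P \<Longrightarrow>
      fst (kf B) \<in> {2, 3} \<and> path_numbering (dominates G) B (fst (kf B)) (snd (kf B))"
    by metis
  \<comment> \<open>The numbering chosen by \<open>kf\<close> might not make the ends of
    \<open>e\<close> consecutive, so on \<open>B0\<close> it is overridden by one that does.\<close>
  define kf' where "kf' = kf(B0 := (k0, f0))"
  have "path_factor {2, 3} \<lparr>verts = verts G, arcs = {e \<in> arcs G. (tail G e, head G e) \<in>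
      {(u, v). \<exists>B\<in>P. u \<in> B \<and> v \<in> B \<and>
        (snd (kf' B) v = Suc (snd (kf' B) u) \<or> snd (kf' B) u = Suc (snd (kf' B) v))}},
      tail = tail G, head = head G\<rparr> G" (is "path_factor _ ?F _")
    using P kf num0
    by (intro path_factor_of_numbered_partition[of P "\<lambda>B. fst (kf' B)"])
      (auto simp: packing_def kf'_def)
  moreover have "e \<in> arcs ?F"
    using e B0 num0(3) by (auto simp: kf'_def intro!: bexI[of _ B0])
  ultimately show "\<exists>F. path_factor {2, 3} F G \<and> e \<in> arcs F"
    by blast
qed

end
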